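(* Consider the multi-market oligopoly of equal capacity $\mathcal{G}$ described in the context, and suppose: each $u_x$ ($x\in E$) is concave and continuously differentiable; $c$ is a convex quadratic function; and at least one of the following holds: (a) all but at most one of the $u_x$ are strictly concave, or (b) $c$ is strictly convex. Then the (unique) pure-strategy Nash equilibrium $\mathbf{S}^*$ of $\mathcal{G}$ is globally asymptotically stable on $S$ under the gradient adjustment process $$\frac{\mathrm{d}\mathbf{s}_i}{\mathrm{d}t}=P_{T(\mathbf{s}_i)}\nabla_i u_i(\mathbf{s}_i;\mathbf{s}_{-i}),\qquad i\in N.$$
   Context: Let $N=\{1,\dots,n\}$ be a set of firms (players) and $E=\{1,\dots,m\}$ a set of markets. Let $\Delta^{m-1}=\{\mathbf{v}\in\mathbb{R}^m:\mathbf{v}\ge 0,\ \mathbf{v}^{T}\mathbf{1}=1\}$. Each firm $i$ chooses a strategy $\mathbf{s}_i=(s_{ix})_{x=1}^m\in S_i=\Delta^{m-1}$. For each market $x$ let $u_x:\mathbb{R}_{\ge 0}\to\mathbb{R}_{\ge 0}$ with $u_x(0)=0$, and let $p_x(t)=u_x(t)/t$ for $t>0$. Let $c:\Delta^{m-1}\to\mathbb{R}_{\ge 0}$ be a common cost function. For a strategy profile $\mathbf{S}=(\mathbf{s}_i)_{i=1}^n$ put $s_x=\sum_{i=1}^n s_{ix}$ and $\mathbf{s}_{-i}=\sum_{j\ne i}\mathbf{s}_j$. The payoff of player $i$ is $u_i(\mathbf{s}_i;\mathbf{s}_{-i})=\sum_{x=1}^m p_x(s_x)s_{ix}-c(\mathbf{s}_i)$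 (a term with $s_x=0$ is taken to be $0$). The game is $\mathcal{G}=(N,S,(u_i)_{i=1}^n)$ with $S=\prod_{i=1}^n\Delta^{m-1}$. In the gradient adjustment process, $\nabla_i$ is the gradient with respect to $\mathbf{s}_i$, $T(\mathbf{s}_i)$ is the tangent cone of $\Delta^{m-1}$ at $\mathbf{s}_i$, and $P_{T(\mathbf{s}_i)}$ is the Euclidean projection onto that cone (at interior points of $\Delta^{m-1}$ it is the centering matrix $I-\mathbf{1}\mathbf{1}^{T}/m$). *)

theory Defs
  imports "HOL-Analysis.Analysis"
begin

definition strictly_convex_on :: "'a::real_vector set \<Rightarrow> ('a \<Rightarrow> real) \<Rightarrow> bool"
  where "strictly_convex_on S f \<longleftrightarrow> convex S \<and>
    (\<forall>x\<in>S. \<forall>y\<in>S. \<forall>a::real. x \<noteq> y \<and> 0 < a \<and> a < 1 \<longrightarrow>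
        f (a *\<^sub>R x + (1 - a) *\<^sub>R y) < a * f x + (1 - a) * f y)"

definition strictly_concave_on :: "'a::real_vector set \<Rightarrow> ('a \<Rightarrow> real) \<Rightarrow> bool"
  where "strictly_concave_on S f \<longleftrightarrow> strictly_convex_on S (\<lambda>x. - f x)"

text \<open>Markets are indexed by the finite type 'm, firms by the finite type 'n.
  A strategy is a vector in real^'m, a profile is in real^'m^'n.\<close>

definition std_simplex :: "(real^'m::finite) set"
  where "std_simplex = {v. (\<forall>x. 0 \<le> v $ x) \<and> (\<Sum>x\<in>UNIV. v $ x) = 1}"

definition orthant :: "(real^'m::finite) set"
  where "orthant = {v. \<forall>x. 0 \<le> v $ x}"

definition profiles :: "(real^'m^'n) set"
  where "profiles = {S. \<forall>i. S $ i \<in> std_simplex}"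

definition others :: "real^'m^'n \<Rightarrow> 'n \<Rightarrow> real^'m"
  where "others S i = (\<Sum>j\<in>UNIV - {i}. S $ j)"

definition price :: "('m \<Rightarrow> real \<Rightarrow> real) \<Rightarrow> 'm \<Rightarrow> real \<Rightarrow> real"
  where "price u x t = u x t / t"

definition payoff :: "('m \<Rightarrow> real \<Rightarrow> real) \<Rightarrow> (real^'m \<Rightarrow> real) \<Rightarrow> 'n \<Rightarrow> real^'m \<Rightarrow> real^'m^'n \<Rightarrow> real"
  where "payoff u c i v S =
     (\<Sum>x\<in>UNIV. (let sx = v $ x + others S i $ x in
                    if sx = 0 then 0 else price u x sx * v $ x)) - c v"

definition nash_equilibrium :: "('m \<Rightarrow> real \<Rightarrow> real) \<Rightarrow> (real^'m \<Rightarrow> real) \<Rightarrow> real^'m^'n \<Rightarrow> bool"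
  where "nash_equilibrium u c S \<longleftrightarrow> S \<in> profiles \<and>
     (\<forall>i. \<forall>v\<in>std_simplex. payoff u c i v S \<le> payoff u c i (S $ i) S)"

definition tangent_cone :: "(real^'m) set \<Rightarrow> real^'m \<Rightarrow> (real^'m::finite) set"
  where "tangent_cone K s = closure {a *\<^sub>R (y - s) | a y. 0 \<le> a \<and> y \<in> K}"

text \<open>gradient of firm i's payoff w.r.t. its own strategy (derivative taken within
  the nonnegative orthant, where it is unique)\<close>
definition own_grad :: "('m \<Rightarrow> real \<Rightarrow> real) \<Rightarrow> (real^'m \<Rightarrow> real) \<Rightarrow> 'n \<Rightarrow> real^'m^'n \<Rightarrow> real^'m"
  where "own_grad u c i S = (SOME g. ((\<lambda>v. payoff u c i v S) has_derivative (\<lambda>h. g \<bullet> h))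
                                      (at (S $ i) within orthant))"

definition grad_field :: "('m \<Rightarrow> real \<Rightarrow> real) \<Rightarrow> (real^'m \<Rightarrow> real) \<Rightarrow> real^'m^'n \<Rightarrow> real^'m^'n"
  where "grad_field u c S =
     (\<chi> i. closest_point (tangent_cone std_simplex (S $ i)) (own_grad u c i S))"

text \<open>(Caratheodory) solutions on [0,\<infinity>) staying in S: X is absolutely continuous with
  X' = grad_field (X t) almost everywhere, written in integral form.\<close>
definition gap_solution :: "('m \<Rightarrow> real \<Rightarrow> real) \<Rightarrow> (real^'m \<Rightarrow> real) \<Rightarrow> (real \<Rightarrow> real^'m^'n) \<Rightarrow> bool"
  where "gap_solution u c X \<longleftrightarrow>
     (\<forall>t\<ge>0. X t \<in> profiles) \<and>
     (\<forall>t\<ge>0. ((\<lambda>\<tau>. grad_field u c (X \<tau>)) has_integral (X t - X 0)) {0..t})"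

definition globally_asymptotically_stable ::
  "('m \<Rightarrow> real \<Rightarrow> real) \<Rightarrow> (real^'m \<Rightarrow> real) \<Rightarrow> real^'m^'n \<Rightarrow> bool"
  where "globally_asymptotically_stable u c Se \<longleftrightarrow>
     (\<forall>\<epsilon>>0. \<exists>\<delta>>0. \<forall>X. gap_solution u c X \<and> dist (X 0) Se < \<delta> \<longrightarrow>
                        (\<forall>t\<ge>0. dist (X t) Se < \<epsilon>)) \<and>
     (\<forall>X. gap_solution u c X \<longrightarrow> (X \<longlongrightarrow> Se) at_top)"

end

theory Submission
  imports Defs
begin

text \<open>Brouwer's theorem yields a strategy \<open>y\<close> such that the symmetric profile \<open>(y, \<dots>, y)\<close> solves the
  variational inequality of the game; since each payoff is concave in the firm's own strategy,
  this profile is an equilibrium. In a market with supplies \<open>a i\<close>, total \<open>s\<close> and mean \<open>z\<close>, the sum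
  of \<open>(a i - y) * (p s + p' s * a i)\<close> over the firms equals its value at the symmetric profile with
  supplies \<open>z\<close> plus \<open>p' s\<close> times the sum of \<open>(a i - z)\<^sup>2\<close>. The extra term is nonpositive, and along
  symmetric profiles the marginal revenue is a convex combination of the decreasing functions \<open>p\<close>
  and \<open>u'\<close>. Hence the payoff gradients point strictly towards \<open>(y, \<dots>, y)\<close> from every other profile,
  which gives uniqueness and makes the squared distance a Lyapunov function; projecting onto the
  tangent cones only improves the inequality. The decay of the squared distance along solutions is
  obtained from the integral equation by subdivision, so no almost-everywhere
  differentiability is needed.\<close>

section \<open>Convexity and one-sided derivatives\<close>

text \<open>Along the segment from \<open>x\<close> to \<open>y\<close> all forward difference
  quotients of \<open>f\<close> at \<open>x\<close> are nonpositive, hence so is their limit. Using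
  the derivative within \<open>K\<close> admits boundary maxima.\<close>

lemma has_derivative_nonpos_at_max:
  fixes f :: "'a::real_normed_vector \<Rightarrow> real"
  assumes D: "(f has_derivative f') (at x within K)" and K: "convex K" "x \<in> K" "y \<in> K"
    and mx: "\<And>z. z \<in> K \<Longrightarrow> f z \<le> f x"
  shows "f' (y - x) \<le> 0"
proof -
  define l where "l = (\<lambda>t::real. x + t *\<^sub>R (y - x))"
  have l: "l t \<in> K" if "t \<in> {0..1}" for t
  proof -
    have "l t = (1 - t) *\<^sub>R x + t *\<^sub>R y" by (simp add: l_def algebra_simps)
    then show ?thesis using that K convexD_alt[of K x y t] by auto
  qed
  have "(l has_derivative (\<lambda>t. t *\<^sub>R (y - x))) (at 0 within {0..1})"
    unfolding l_def by (auto intro!: derivative_eq_intros)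
  moreover have "(f has_derivative f') (at (l 0) within l ` {0..1})"
    using has_derivative_subset[OF D image_subsetI[of "{0..1}" l K, OF l]]
    by (simp add: l_def)
  ultimately have "((f \<circ> l) has_derivative (f' \<circ> (\<lambda>t. t *\<^sub>R (y - x)))) (at 0 within {0..1})"
    by (rule diff_chain_within)
  moreover have "f' \<circ> (\<lambda>t. t *\<^sub>R (y - x)) = (*) (f' (y - x))"
    using has_derivative_bounded_linear[OF D]
    by (auto simp: fun_eq_iff linear_scale bounded_linear.linear)
  ultimately have "((f \<circ> l) has_real_derivative f' (y - x)) (at 0 within {0..1})"
    by (simp add: has_field_derivative_def)
  then have lim: "((\<lambda>t. (f (l t) - f x) / t) \<longlongrightarrow> f' (y - x)) (at 0 within {0..1})"
    by (simp add: has_field_derivative_iff l_def)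
  have "\<forall>\<^sub>F t in at 0 within {0..1}. (f (l t) - f x) / t \<le> 0"
    using mx l by (auto simp: eventually_at_filter divide_le_0_iff intro!: always_eventually)
  moreover have "at (0::real) within {0..1} \<noteq> bot"
    by (simp add: at_within_Icc_at_right)
  ultimately show ?thesis
    using tendsto_upperbound[OF lim] by blast
qed

text \<open>By concavity the chord from \<open>x\<close> to \<open>y\<close> minus \<open>f\<close>
  along it, the function \<open>g\<close>, is largest at parameter 0, so its one-sided derivative
  there is nonpositive. This covers the endpoint 0 of the half-line, where the derivative is
  one-sided.\<close>

lemma concave_on_below_tangent:
  fixes f :: "real \<Rightarrow> real"
  assumes cv: "concave_on K f" and D: "(f has_real_derivative D) (at x within K)"
    and xy: "x \<in> K" "y \<in> K"
  shows "f y \<le> f x + D * (y - x)"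
proof -
  have K: "convex K" using cv by (simp add: concave_on_imp_convex)
  define l where "l = (\<lambda>t::real. x + t * (y - x))"
  define g where "g = (\<lambda>t. t * (f y - f x) - f (l t))"
  have l: "l t \<in> K" "f (l t) \<ge> (1 - t) * f x + t * f y" if "t \<in> {0..1}" for t
  proof -
    have e: "l t = (1 - t) *\<^sub>R x + t *\<^sub>R y" by (simp add: l_def algebra_simps)
    then show "l t \<in> K" using that K xy convexD_alt[of K x y t] by auto
    show "f (l t) \<ge> (1 - t) * f x + t * f y"
      unfolding e using that cv xy
      by (auto simp: concave_on_iff)
  qed
  have "(l has_real_derivative (y - x)) (at 0 within {0..1})"
    unfolding l_def by (auto intro!: derivative_eq_intros)
  moreover have "(f has_real_derivative D) (at (l 0) within l ` {0..1})"
    using has_field_derivative_subset[OF D image_subsetI[of "{0..1}" l K, OF l(1)]]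
    by (simp add: l_def)
  ultimately have "((f \<circ> l) has_real_derivative (D * (y - x))) (at 0 within {0..1})"
    by (rule DERIV_image_chain[rotated])
  then have "(g has_real_derivative (f y - f x - D * (y - x))) (at 0 within {0..1})"
    unfolding g_def o_def by (auto intro!: derivative_eq_intros)
  then have "(g has_derivative (*) (f y - f x - D * (y - x))) (at 0 within {0..1})"
    by (simp add: has_field_derivative_def)
  moreover have "g t \<le> g 0" if "t \<in> {0..1}" for t
    using l(2)[OF that] by (simp add: g_def l_def algebra_simps)
  ultimately have "(f y - f x - D * (y - x)) * (1 - 0) \<le> 0"
    by (intro has_derivative_nonpos_at_max[of g _ 0 "{0..1}" 1]) auto
  then show ?thesis by simp
qed

section \<open>Revenue in a single market\<close>

locale market =
  fixes u u' :: "real \<Rightarrow> real"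
  assumes u0: "u 0 = 0"
    and concave: "concave_on {0..} u"
    and deriv: "\<And>t. 0 \<le> t \<Longrightarrow> (u has_real_derivative u' t) (at t within {0..})"
    and cont: "continuous_on {0..} u'"
begin

text \<open>The continuous extension of the price to zero supply: since \<open>u 0 = 0\<close>, the
  limit of \<open>u t / t\<close> at 0 is \<open>u' 0\<close>.\<close>

definition pbar :: "real \<Rightarrow> real"
  where "pbar t = (if t = 0 then u' 0 else u t / t)"

text \<open>\<open>marg a s\<close> is the derivative of \<open>t p(t + s - a)\<close> at \<open>t = a\<close>, i.e. the marginal revenue of
  a firm supplying \<open>a\<close> of a total of \<open>s\<close>. For \<open>s = 0\<close> the junk value \<open>a / 0 = 0\<close> gives the
  correct limit \<open>u' 0\<close>.\<close>
definition marg :: "real \<Rightarrow> real \<Rightarrow> real"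
  where "marg a s = pbar s + (u' s - pbar s) * (a / s)"

section \<open>Tangent inequalities and monotonicity of price and derivative\<close>

lemma tangent: "0 \<le> s \<Longrightarrow> 0 \<le> t \<Longrightarrow> u t \<le> u s + u' s * (t - s)"
  by (rule concave_on_below_tangent[OF concave deriv]) auto

text \<open>At the midpoint \<open>u\<close> lies strictly above the chord and still weakly below
  the tangent at \<open>s\<close>; doubling the gap carries strictness to \<open>t\<close>.\<close>

lemma strict_tangent:
  assumes "strictly_concave_on {0..} u" "0 \<le> s" "0 \<le> t" "s \<noteq> t"
  shows "u t < u s + u' s * (t - s)"
proof -
  define m where "m = (1/2) *\<^sub>R s + (1 - 1/2) *\<^sub>R t"
  have "- u m < (1/2) * - u s + (1 - 1/2) * - u t"
    using assms(1)[unfolded strictly_concave_on_def strictly_convex_on_def, THEN conjunct2,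
        rule_format, of s t "1/2"] assms unfolding m_def by simp
  moreover have "u m \<le> u s + u' s * (m - s)"
    using assms by (intro tangent) (auto simp: m_def)
  moreover have "m - s = (t - s) / 2" by (simp add: m_def field_simps)
  ultimately show ?thesis by (simp add: field_simps)
qed

text \<open>The tangent at \<open>s\<close> lies above \<open>u 0 = 0\<close> at the origin. As
  \<open>p' s = (u' s - p s) / s\<close>, this is the sign of the price slope.\<close>

lemma deriv_le_pbar:
  assumes "0 \<le> s" shows "u' s \<le> pbar s"
  using tangent[of s 0] assms u0 by (auto simp: pbar_def field_simps)

lemma deriv_less_pbar:
  assumes "strictly_concave_on {0..} u" "0 < s" shows "u' s < pbar s"
  using strict_tangent[OF assms(1), of s 0] assms u0 by (auto simp: pbar_def field_simps)

lemma deriv_antimono: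
  assumes "0 \<le> s" "s \<le> t" shows "u' t \<le> u' s"
proof (cases "s = t")
  case False
  have "(u' t - u' s) * (t - s) \<le> 0"
    using tangent[of s t] tangent[of t s] assms by (simp add: algebra_simps)
  then show ?thesis using False assms by (simp add: mult_le_0_iff)
qed simp

lemma deriv_strict_antimono:
  assumes "strictly_concave_on {0..} u" "0 \<le> s" "s < t" shows "u' t < u' s"
proof -
  have "(u' t - u' s) * (t - s) < 0"
    using strict_tangent[OF assms(1), of s t] strict_tangent[OF assms(1), of t s] assms
    by (simp add: algebra_simps)
  then show ?thesis using assms by (simp add: mult_less_0_iff)
qed

lemma pbar_antimono:
  assumes "0 \<le> s" "s \<le> t" shows "pbar t \<le> pbar s"
proof (cases "s = 0")
  case True
  then show ?thesis using tangent[of 0 t] assms u0 by (auto simp: pbar_def field_simps)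
next
  case False
  have "u' s * (t - s) \<le> u s / s * (t - s)"
    using deriv_le_pbar[of s] False assms by (intro mult_right_mono) (auto simp: pbar_def)
  then have "u t \<le> u s + u s / s * (t - s)" using tangent[of s t] assms by linarith
  also have "\<dots> = u s / s * t" using False by (simp add: field_simps)
  finally show ?thesis using False assms by (simp add: pbar_def field_simps)
qed

section \<open>Marginal revenue compared with a symmetric profile\<close>

lemma marg_symmetric:
  assumes "0 < n" shows "marg y (n * y) = (1 - 1 / n) * pbar (n * y) + (1 / n) * u' (n * y)"
  using assms by (auto simp: marg_def pbar_def field_simps)

lemma marg_symmetric_antimono:
  assumes "1 \<le> n" "0 \<le> y" "y \<le> z"
  shows "marg z (n * z) \<le> marg y (n * y)"
proof -
  have "pbar (n * z) \<le> pbar (n * y)" "u' (n * z) \<le> u' (n * y)"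
    using assms by (auto intro!: pbar_antimono deriv_antimono)
  then have "(1 - 1 / n) * pbar (n * z) \<le> (1 - 1 / n) * pbar (n * y)"
    "(1 / n) * u' (n * z) \<le> (1 / n) * u' (n * y)"
    using assms by (auto intro!: mult_left_mono divide_right_mono)
  moreover have "marg v (n * v) = (1 - 1 / n) * pbar (n * v) + (1 / n) * u' (n * v)" for v
    using assms by (intro marg_symmetric) simp
  ultimately show ?thesis by simp
qed

text \<open>Strictness is drawn from the \<open>u'\<close> term, whose weight \<open>1 / n\<close>
  is positive even for a single firm, where the weight of the price vanishes.\<close>

lemma marg_symmetric_strict_antimono:
  assumes "strictly_concave_on {0..} u" "1 \<le> n" "0 \<le> y" "y < z"
  shows "marg z (n * z) < marg y (n * y)"
proof -
  have "(1 - 1 / n) * pbar (n * z) \<le> (1 - 1 / n) * pbar (n * y)"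
    using assms by (auto intro!: pbar_antimono mult_left_mono)
  moreover have "u' (n * z) < u' (n * y)"
    using assms by (auto intro!: deriv_strict_antimono)
  then have "(1 / n) * u' (n * z) < (1 / n) * u' (n * y)"
    using assms by (intro mult_strict_left_mono) auto
  moreover have "marg v (n * v) = (1 - 1 / n) * pbar (n * v) + (1 / n) * u' (n * v)" for v
    using assms by (intro marg_symmetric) simp
  ultimately show ?thesis by simp
qed

text \<open>For fixed total \<open>s\<close>, marginal revenue is affine in the own supply with
  slope \<open>D\<close>, the price slope. The left side therefore depends on \<open>a\<close> only
  through \<open>s\<close> and the sum of squares, and the latter splits into a mean and a variance
  part.\<close>

lemma marg_monotone_identity:
  fixes a :: "'n::finite \<Rightarrow> real" and y :: real
  defines "s \<equiv> \<Sum>i\<in>UNIV. a i" and "n \<equiv> real CARD('n)"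
  defines "z \<equiv> s / n"
  shows "(\<Sum>i\<in>UNIV. (a i - y) * (marg (a i) s - marg y (n * y))) =
    n * ((z - y) * (marg z (n * z) - marg y (n * y)))
      + (u' s - pbar s) / s * (\<Sum>i\<in>UNIV. (a i - z)\<^sup>2)"
proof -
  have n: "n > 0" by (simp add: n_def)
  have nz: "n * z = s" using n by (simp add: z_def)
  define D where "D = (u' s - pbar s) / s"
  define q where "q = (\<Sum>i\<in>UNIV. (a i)\<^sup>2)"
  define K where "K = marg y (n * y)"
  have mD: "marg v s = pbar s + D * v" for v by (simp add: marg_def D_def)
  have sc: "(\<Sum>i\<in>(UNIV::'n set). r) = n * r" for r :: real
    by (simp add: n_def)
  have "(\<Sum>i\<in>UNIV. (a i - y) * (marg (a i) s - K))
      = (\<Sum>i\<in>UNIV. a i * (pbar s - K) - y * (pbar s - K) + D * (a i)\<^sup>2 - y * D * a i)"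
    by (rule sum.cong) (auto simp: mD algebra_simps power2_eq_square)
  also have "\<dots> = s * (pbar s - K) - n * (y * (pbar s - K)) + D * q - y * D * s"
    by (simp only: sum.distrib sum_subtractf sum_distrib_left[symmetric]
        sum_distrib_right[symmetric] s_def[symmetric] q_def[symmetric] sc) (simp add: algebra_simps)
  finally have L: "(\<Sum>i\<in>UNIV. (a i - y) * (marg (a i) s - K))
      = s * (pbar s - K) - n * (y * (pbar s - K)) + D * q - y * D * s" .
  have "(\<Sum>i\<in>UNIV. (a i - z)\<^sup>2) = (\<Sum>i\<in>UNIV. (a i)\<^sup>2 - 2 * z * a i + z\<^sup>2)"
    by (rule sum.cong) (auto simp: algebra_simps power2_eq_square)
  also have "\<dots> = q - 2 * z * s + n * z\<^sup>2"
    by (simp only: sum.distrib sum_subtractf sum_distrib_left[symmetric]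
        s_def[symmetric] q_def[symmetric] sc)
  also have "\<dots> = q - z * s" using nz by (simp add: power2_eq_square algebra_simps)
  finally have Q: "(\<Sum>i\<in>UNIV. (a i - z)\<^sup>2) = q - z * s" .
  have M: "marg z (n * z) = pbar s + D * z"
    by (simp add: nz mD)
  have "s * (pbar s - K) - n * (y * (pbar s - K)) + D * q - y * D * s =
      n * ((z - y) * (pbar s + D * z - K)) + D * (q - z * s)"
    unfolding nz[symmetric] by (simp add: algebra_simps)
  then show ?thesis unfolding L[unfolded K_def] Q M D_def[symmetric] K_def .
qed

text \<open>Both terms of the identity are nonpositive. Under strict concavity the first is negative
  when the mean \<open>z\<close> differs from \<open>y\<close>; when it equals \<open>y\<close>, the
  supplies have positive variance and the second is negative.\<close>

lemma marg_monotone: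
  fixes a :: "'n::finite \<Rightarrow> real" and y :: real
  assumes a: "\<And>i. 0 \<le> a i" and y: "0 \<le> y"
  defines "s \<equiv> \<Sum>i\<in>UNIV. a i" and "n \<equiv> real CARD('n)"
  shows "(\<Sum>i\<in>UNIV. (a i - y) * (marg (a i) s - marg y (n * y))) \<le> 0"
    and "strictly_concave_on {0..} u \<Longrightarrow> a i \<noteq> y \<Longrightarrow>
      (\<Sum>i\<in>UNIV. (a i - y) * (marg (a i) s - marg y (n * y))) < 0"
proof -
  define z where "z = s / n"
  define A where "A = (z - y) * (marg z (n * z) - marg y (n * y))"
  define B where "B = (u' s - pbar s) / s * (\<Sum>i\<in>UNIV. (a i - z)\<^sup>2)"
  have id: "(\<Sum>i\<in>UNIV. (a i - y) * (marg (a i) s - marg y (n * y))) = n * A + B"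
    unfolding A_def B_def z_def s_def n_def by (rule marg_monotone_identity)
  have n: "n \<ge> 1" by (simp add: n_def Suc_le_eq)
  have s: "s \<ge> 0" using a by (auto simp: s_def intro: sum_nonneg)
  have z: "z \<ge> 0" using n s by (simp add: z_def)
  have A: "A \<le> 0"
    unfolding A_def
    using marg_symmetric_antimono[OF n y, of z] marg_symmetric_antimono[OF n z, of y]
    by (cases "y \<le> z") (auto simp: mult_le_0_iff)
  have B: "B \<le> 0"
    unfolding B_def using deriv_le_pbar[OF s] s
    by (intro mult_nonpos_nonneg sum_nonneg) (auto simp: divide_le_0_iff)
  have "n * A \<le> 0" using A n by (simp add: mult_le_0_iff)
  then show "(\<Sum>i\<in>UNIV. (a i - y) * (marg (a i) s - marg y (n * y))) \<le> 0"
    unfolding id using B by simp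
  assume sc: "strictly_concave_on {0..} u" and i: "a i \<noteq> y"
  show "(\<Sum>i\<in>UNIV. (a i - y) * (marg (a i) s - marg y (n * y))) < 0"
  proof (cases "z = y")
    case False
    then have "A < 0" unfolding A_def
      using marg_symmetric_strict_antimono[OF sc n y, of z]
        marg_symmetric_strict_antimono[OF sc n z, of y]
      by (cases "y < z") (auto simp: mult_less_0_iff)
    then have "n * A < 0" using n by (simp add: mult_less_0_iff)
    then show ?thesis unfolding id using B by simp
  next
    case True
    \<comment> \<open>The strict bound of \<open>u'\<close> by the price is available at positive
      totals only; a zero total would force \<open>a i = 0 = z = y\<close>.\<close>
    have "s \<noteq> 0"
    proof
      assume "s = 0"
      then have "a i = 0" using a by (simp add: s_def sum_nonneg_eq_0_iff)
      then show False using i True \<open>s = 0\<close> by (simp add: z_def)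
    qed
    with s have s': "s > 0" by simp
    have "(a i - z)\<^sup>2 > 0" using i True by simp
    then have "(\<Sum>i\<in>UNIV. (a i - z)\<^sup>2) > 0"
      by (intro sum_pos2[of UNIV i]) auto
    then have "B < 0" unfolding B_def using deriv_less_pbar[OF sc s'] s'
      by (intro mult_neg_pos) (auto simp: divide_less_0_iff)
    then show ?thesis unfolding id using \<open>n * A \<le> 0\<close> by simp
  qed
qed

section \<open>Revenue as a function of the own supply\<close>

text \<open>The revenue \<open>t p(t + r)\<close> is concave in \<open>t\<close>: \<open>u\<close> is a minimum of affine functions with
  nonnegative value at 0, and for these the claim reduces to the convexity of \<open>1 / t\<close>.\<close>
lemma revenue_below_tangent:
  assumes "0 \<le> v" "0 \<le> w" "0 \<le> r"
  shows "v * pbar (v + r) \<le> w * pbar (w + r) + marg w (w + r) * (v - w)"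
proof (cases "r = 0")
  case True
  have "t * pbar t = u t" for t using u0 by (simp add: pbar_def)
  moreover have "marg w w = u' w" by (auto simp: marg_def pbar_def)
  ultimately show ?thesis using True tangent[of w v] assms by simp
next
  case False
  define s where "s = v + r"
  define t where "t = w + r"
  have st: "s > 0" "t > 0" "v = s - r" "w = t - r" using False assms by (auto simp: s_def t_def)
  \<comment> \<open>The intercept at 0 of the tangent to \<open>u\<close> at
    \<open>t\<close>.\<close>
  define k where "k = u t - u' t * t"
  have k: "k \<ge> 0" using tangent[of t 0] st u0 by (simp add: k_def algebra_simps)
  have ut: "u t = k + u' t * t" by (simp add: k_def)
  have us: "u s \<le> k + u' t * s" using tangent[of t s] st by (simp add: k_def algebra_simps)
  have "v * pbar s = v / s * u s" using st by (simp add: pbar_def)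
  also have "\<dots> \<le> v / s * (k + u' t * s)" using us st assms by (intro mult_left_mono) auto
  also have "\<dots> = u' t * v + k * (v / s)" using st by (simp add: field_simps)
  also have "\<dots> \<le> u' t * v + k * (w / t + (v - w) * r / t\<^sup>2)"
  proof -
    \<comment> \<open>Since \<open>v / s = 1 - r / s\<close>, this is the explicit gap between this
      concave function of \<open>s\<close> and its tangent at \<open>t\<close>.\<close>
    have "w / t + (v - w) * r / t\<^sup>2 - v / s = r * (s - t)\<^sup>2 / (t\<^sup>2 * s)"
      using st(1,2) unfolding st(3,4) by (simp add: field_simps power2_eq_square)
    also have "\<dots> \<ge> 0" using st(1,2) assms by simp
    finally show ?thesis using k by (intro add_left_mono mult_left_mono) auto
  qed
  also have "\<dots> = w * pbar t + marg w t * (v - w)"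
  proof -
    have p: "pbar t = u' t + k / t" using st(1,2) by (simp add: pbar_def ut field_simps)
    have m: "marg w t = u' t + k / t - k / t * (w / t)" by (simp add: marg_def p algebra_simps)
    have r: "r = t - w" using st by simp
    show ?thesis unfolding m p r using st(1,2) by (simp add: field_simps power2_eq_square)
  qed
  finally show ?thesis by (simp add: s_def t_def)
qed

lemma revenue_has_derivative:
  assumes "0 \<le> w" "0 \<le> r"
  shows "((\<lambda>t. t * pbar (t + r)) has_real_derivative marg w (w + r)) (at w within {0..})"
proof (cases "r = 0")
  case True
  have "t * pbar t = u t" for t using u0 by (simp add: pbar_def)
  moreover have "marg w w = u' w" by (auto simp: marg_def pbar_def)
  ultimately show ?thesis using True deriv[of w] assms by simp
next
  case False
  then have r: "r > 0" using assms by simp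
  have "(u has_real_derivative u' (w + r)) (at (w + r) within (\<lambda>t. t + r) ` {0..})"
    using deriv[of "w + r"] assms by (auto intro: has_field_derivative_subset)
  moreover have "((\<lambda>t. t + r) has_real_derivative 1) (at w within {0..})"
    by (auto intro!: derivative_eq_intros)
  ultimately have "((\<lambda>t. u (t + r)) has_real_derivative u' (w + r)) (at w within {0..})"
    using DERIV_image_chain[of u "u' (w + r)" "\<lambda>t. t + r" w "{0..}" 1] by (simp add: o_def)
  then have "((\<lambda>t. t * (u (t + r) / (t + r))) has_real_derivative
      1 * (u (w + r) / (w + r)) + (u' (w + r) * (w + r) - u (w + r)) / ((w + r) * (w + r)) * w)
      (at w within {0..})"
    using DERIV_mult[OF DERIV_ident DERIV_divide[OF _ DERIV_add[OF DERIV_ident DERIV_const]]]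
      r assms by fastforce
  moreover have "1 * (u (w + r) / (w + r)) + (u' (w + r) * (w + r) - u (w + r)) / ((w + r) * (w + r)) * w
      = marg w (w + r)"
  proof -
    have "(x * k - y) / (k * k) * w = (x - y / k) * (w / k)" if "k \<noteq> 0" for x y k :: real
      using that by (simp add: field_simps)
    then show ?thesis using r assms by (simp add: marg_def pbar_def)
  qed
  ultimately have "((\<lambda>t. t * (u (t + r) / (t + r))) has_real_derivative marg w (w + r))
      (at w within {0..})" by simp
  then show ?thesis
    by (rule has_field_derivative_transform_within[of _ _ _ _ 1])
      (use r assms in \<open>auto simp: pbar_def\<close>)
qed

lemma continuous_on_pbar: "continuous_on {0..} pbar"
proof (rule continuous_on_eq_continuous_within[THEN iffD2], rule ballI)
  fix t :: real assume t: "t \<in> {0..}"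
  show "continuous (at t within {0..}) pbar"
  proof (cases "t = 0")
    \<comment> \<open>At zero the price is the difference quotient of \<open>u\<close>, whose limit
      is the one-sided derivative.\<close>
    case True
    have "((\<lambda>y. (u y - u 0) / (y - 0)) \<longlongrightarrow> u' 0) (at 0 within {0..})"
      using deriv[of 0] by (simp add: has_field_derivative_iff)
    then have "(pbar \<longlongrightarrow> u' 0) (at 0 within {0..})"
      by (rule Lim_transform_within[of _ _ _ _ 1]) (auto simp: pbar_def u0)
    then show ?thesis using True by (simp add: continuous_within pbar_def)
  next
    case False
    then have t: "t > 0" using t by simp
    have "continuous (at t within {0..}) u"
      using deriv[of t] t by (auto intro: DERIV_continuous)
    then have "continuous (at t within {0..}) (\<lambda>t. u t / t)"
      using t by (intro continuous_intros) auto
    then show ?thesis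
      by (rule continuous_transform_within[of _ _ _ t]) (use t in \<open>auto simp: pbar_def dist_real_def\<close>)
  qed
qed

text \<open>The share \<open>f z / g z\<close> may jump where the total vanishes, but it stays in
  [0, 1] and its factor \<open>u' - pbar\<close> tends to 0 there, so the product is squeezed to
  0.\<close>

lemma continuous_on_marg:
  fixes f g :: "'a::metric_space \<Rightarrow> real"
  assumes f: "continuous_on A f" and g: "continuous_on A g"
    and fg: "\<And>z. z \<in> A \<Longrightarrow> 0 \<le> f z \<and> f z \<le> g z"
  shows "continuous_on A (\<lambda>z. marg (f z) (g z))"
proof -
  have g0: "g ` A \<subseteq> {0..}" using fg by force
  have p: "continuous_on A (\<lambda>z. pbar (g z))"
    using continuous_on_compose2[OF continuous_on_pbar g g0] .
  have "continuous_on A (\<lambda>z. u' (g z))"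
    using continuous_on_compose2[OF cont g g0] .
  with p have d: "continuous_on A (\<lambda>z. u' (g z) - pbar (g z))"
    by (intro continuous_intros)
  have "continuous_on A (\<lambda>z. (u' (g z) - pbar (g z)) * (f z / g z))"
  proof (rule continuous_on_eq_continuous_within[THEN iffD2], rule ballI)
    fix z assume z: "z \<in> A"
    have dz: "((\<lambda>z. u' (g z) - pbar (g z)) \<longlongrightarrow> u' (g z) - pbar (g z)) (at z within A)"
      using d z by (simp add: continuous_on_def)
    show "continuous (at z within A) (\<lambda>z. (u' (g z) - pbar (g z)) * (f z / g z))"
    proof (cases "g z = 0")
      case True
      have "((\<lambda>z. (u' (g z) - pbar (g z)) * (f z / g z)) \<longlongrightarrow> 0) (at z within A)"
      proof (rule Lim_null_comparison)
        show "((\<lambda>z. norm (u' (g z) - pbar (g z))) \<longlongrightarrow> 0) (at z within A)"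
          using dz True by (intro tendsto_norm_zero) (simp add: pbar_def)
        have "norm ((u' (g y) - pbar (g y)) * (f y / g y)) \<le> norm (u' (g y) - pbar (g y)) * 1"
          if "y \<in> A" for y
          unfolding norm_mult using fg[OF that]
          by (intro mult_left_mono) (auto simp: divide_le_eq_1)
        then show "\<forall>\<^sub>F y in at z within A. norm ((u' (g y) - pbar (g y)) * (f y / g y))
            \<le> norm (u' (g y) - pbar (g y))"
          by (auto simp: eventually_at_filter intro!: always_eventually)
      qed
      then show ?thesis using True by (simp add: continuous_within)
    next
      case False
      then show ?thesis
        unfolding continuous_within using dz f g z
        by (intro tendsto_mult tendsto_divide) (auto simp: continuous_on_def)
    qed
  qed
  with p show ?thesis unfolding marg_def by (rule continuous_on_add)
qed

end

section \<open>Tangent cones and the projected field\<close>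

lemma convex_cone_tangent_cone:
  assumes "convex K" "s \<in> K"
  shows "convex_cone (tangent_cone K s)"
proof -
  let ?C = "conic hull ((\<lambda>y. y - s) ` K)"
  have "{a *\<^sub>R (y - s) | a y. 0 \<le> a \<and> y \<in> K} = ?C"
    unfolding conic_hull_explicit by blast
  then have T: "tangent_cone K s = closure ?C" by (simp add: tangent_cone_def)
  have "convex ((\<lambda>y. y - s) ` K)" using assms by (simp add: convex_translation_subtract)
  then have "convex (closure ?C)" by (intro convex_closure convex_conic_hull)
  moreover have "conic (closure ?C)" by (intro conic_closure conic_conic_hull)
  moreover have "s - s \<in> ?C" using assms by (intro hull_inc) blast
  then have "closure ?C \<noteq> {}" by fastforce
  ultimately show ?thesis unfolding T convex_cone_def by simp
qed

lemma diff_in_tangent_cone: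
  assumes "y \<in> K" shows "y - s \<in> tangent_cone K s"
  unfolding tangent_cone_def
proof (rule subsetD[OF closure_subset], rule CollectI, intro exI conjI)
  show "y - s = 1 *\<^sub>R (y - s)" by simp
qed (use assms in auto)

text \<open>Projection onto a closed convex set is nonexpansive and fixes 0, which gives the norm
  bound. Testing the obtuse-angle property at \<open>P\<close> with the cone element
  \<open>P + (e - s)\<close> gives the second inequality: projecting only increases the component
  pointing towards \<open>e\<close>.\<close>

lemma tangent_cone_projection:
  fixes g :: "real^'m::finite"
  assumes K: "convex K" "s \<in> K"
  defines "P \<equiv> closest_point (tangent_cone K s) g"
  shows "norm P \<le> norm g"
    and "e \<in> K \<Longrightarrow> P \<bullet> (s - e) \<le> g \<bullet> (s - e)"
proof -
  let ?T = "tangent_cone K s"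
  have cc: "convex_cone ?T" using convex_cone_tangent_cone[OF K] .
  then have cv: "convex ?T" "0 \<in> ?T"
    by (auto simp: convex_cone_def convex_cone_contains_0)
  have cl: "closed ?T" by (simp add: tangent_cone_def)
  have "dist P (closest_point ?T 0) \<le> dist g 0"
    unfolding P_def using cv cl by (intro closest_point_lipschitz) auto
  then show "norm P \<le> norm g" using cv by (simp add: closest_point_self)
  assume e: "e \<in> K"
  have "P \<in> ?T" unfolding P_def using cv cl by (intro closest_point_in_set) auto
  then have "P + (e - s) \<in> ?T" using cc diff_in_tangent_cone[OF e] by (intro convex_cone_add)
  from closest_point_dot[OF cv(1) cl this, of g]
  show "P \<bullet> (s - e) \<le> g \<bullet> (s - e)" by (simp add: P_def algebra_simps)
qed

section \<open>Decay of the squared distance along integral curves\<close>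

text \<open>With \<open>[a, b]\<close> cut into \<open>k + 1\<close> equal pieces the quadratic
  errors add up to \<open>C * (b - a)\<^sup>2 / (k + 1)\<close>, which vanishes in the
  limit.\<close>

lemma nonincreasing_if_quadratic_bound:
  fixes h :: "real \<Rightarrow> real"
  assumes ab: "a \<le> b"
    and bd: "\<And>s t. a \<le> s \<Longrightarrow> s \<le> t \<Longrightarrow> t \<le> b \<Longrightarrow> h t - h s \<le> C * (t - s)\<^sup>2"
  shows "h b \<le> h a"
proof -
  have N: "h b - h a \<le> C * (b - a)\<^sup>2 / real (Suc k)" for k
  proof -
    define N where "N = real (Suc k)"
    have N: "N > 0" by (simp add: N_def)
    define p where "p = (\<lambda>j. a + real j * ((b - a) / N))"
    have p: "p (Suc j) - p j = (b - a) / N" for j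
      by (simp add: p_def distrib_right add_divide_distrib)
    have "h (p (Suc j)) - h (p j) \<le> C * ((b - a) / N)\<^sup>2" if "j < Suc k" for j
    proof -
      have "real (Suc j) * ((b - a) / N) \<le> N * ((b - a) / N)"
        using that ab N by (intro mult_right_mono) (auto simp: N_def)
      then have "p (Suc j) \<le> b" using N by (simp add: p_def)
      moreover have "0 \<le> (b - a) / N" using ab N by simp
      then have "p j \<le> p (Suc j)" using p[of j] by linarith
      moreover have "a \<le> p j" using ab N by (simp add: p_def)
      ultimately show ?thesis using bd[of "p j" "p (Suc j)"] by (simp only: p)
    qed
    then have "(\<Sum>j<Suc k. h (p (Suc j)) - h (p j)) \<le> (\<Sum>j<Suc k. C * ((b - a) / N)\<^sup>2)"
      by (intro sum_mono) simp
    also have "(\<Sum>j<Suc k. h (p (Suc j)) - h (p j)) = h (p (Suc k)) - h (p 0)"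
      by (rule sum_lessThan_telescope)
    also have "p (Suc k) = b" using N by (simp only: p_def N_def[symmetric]) simp
    also have "p 0 = a" by (simp add: p_def)
    also have "(\<Sum>j<Suc k. C * ((b - a) / N)\<^sup>2) = N * (C * ((b - a) / N)\<^sup>2)"
      by (simp add: N_def)
    also have "\<dots> = C * (b - a)\<^sup>2 / N" using N by (simp add: power2_eq_square)
    finally show ?thesis by (simp add: N_def)
  qed
  have "(\<lambda>k. C * (b - a)\<^sup>2 / real (Suc k)) \<longlonglongrightarrow> 0"
    by (rule LIMSEQ_Suc) (rule lim_const_over_n)
  then have "h b - h a \<le> 0"
    by (rule LIMSEQ_le_const) (use N in auto)
  then show ?thesis by simp
qed

text \<open>\<open>X\<close> is Lipschitz with constant \<open>B\<close>, so on
  \<open>[s, t]\<close> replacing \<open>X r\<close> by \<open>X s\<close> in the dissipation bound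
  costs at most \<open>B\<^sup>2 * (t - s)\<close>. Expanding the square at time \<open>t\<close>
  leaves an error of order \<open>(t - s)\<^sup>2\<close>: twice \<open>B\<^sup>2\<close> from this
  replacement and once from the increment.\<close>

lemma sqdist_decay:
  fixes X f :: "real \<Rightarrow> 'a::euclidean_space"
  assumes ab: "a \<le> b"
    and int: "\<And>s t. a \<le> s \<Longrightarrow> s \<le> t \<Longrightarrow> t \<le> b \<Longrightarrow> (f has_integral (X t - X s)) {s..t}"
    and B: "\<And>t. t \<in> {a..b} \<Longrightarrow> norm (f t) \<le> B"
    and diss: "\<And>t. t \<in> {a..b} \<Longrightarrow> f t \<bullet> (X t - e) \<le> - w"
  shows "(norm (X b - e))\<^sup>2 \<le> (norm (X a - e))\<^sup>2 - 2 * w * (b - a)"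
proof -
  have B0: "B \<ge> 0" using B[of a] ab norm_ge_zero[of "f a"] by (smt (verit) atLeastAtMost_iff)
  have lip: "norm (X t - X s) \<le> B * (t - s)" if "a \<le> s" "s \<le> t" "t \<le> b" for s t
    using has_integral_bound_real[OF B0, of "{}" f "X t - X s" s t] int[OF that] B that by auto
  define h where "h = (\<lambda>t. (norm (X t - e))\<^sup>2 + 2 * w * t)"
  have "h t - h s \<le> 3 * B\<^sup>2 * (t - s)\<^sup>2" if st: "a \<le> s" "s \<le> t" "t \<le> b" for s t
  proof -
    have le: "f r \<bullet> (X s - e) \<le> - w + B\<^sup>2 * (t - s)" if r: "r \<in> {s..t}" for r
    proof -
      have "f r \<bullet> (X s - X r) \<le> norm (f r) * norm (X s - X r)" by (rule norm_cauchy_schwarz)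
      also have "\<dots> \<le> B * (B * (r - s))"
        using B[of r] lip[of s r] B0 r st by (intro mult_mono) (auto simp: norm_minus_commute)
      also have "\<dots> \<le> B * (B * (t - s))" using B0 r by (intro mult_left_mono) auto
      finally show ?thesis using diss[of r] r st
        by (simp add: algebra_simps power2_eq_square)
    qed
    have "((\<lambda>r. f r \<bullet> (X s - e)) has_integral ((X t - X s) \<bullet> (X s - e))) {s..t}"
      using has_integral_linear[OF int[OF st] bounded_linear_inner_left[of "X s - e"]]
      by (simp add: o_def)
    moreover have "((\<lambda>r. - w + B\<^sup>2 * (t - s)) has_integral (t - s) * (- w + B\<^sup>2 * (t - s))) {s..t}"
      using has_integral_const_real[of "- w + B\<^sup>2 * (t - s)" s t] st by simp
    ultimately have i: "(X t - X s) \<bullet> (X s - e) \<le> (t - s) * (- w + B\<^sup>2 * (t - s))"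
      by (rule has_integral_le) (use le in auto)
    have "(norm (X t - X s))\<^sup>2 \<le> (B * (t - s))\<^sup>2"
      using lip[OF st] by (intro power_mono) auto
    moreover have "(norm (X t - e))\<^sup>2
        = (norm (X s - e))\<^sup>2 + 2 * ((X t - X s) \<bullet> (X s - e)) + (norm (X t - X s))\<^sup>2"
      unfolding power2_norm_eq_inner by (simp add: inner_commute algebra_simps)
    ultimately show ?thesis using i
      by (simp add: h_def power_mult_distrib) (simp add: algebra_simps power2_eq_square)
  qed
  then have "h b \<le> h a" by (rule nonincreasing_if_quadratic_bound[OF ab])
  then show ?thesis by (simp add: h_def algebra_simps)
qed

section \<open>The simplex\<close>

lemma convex_std_simplex: "convex (std_simplex :: (real^'m::finite) set)"
  by (rule convexI)
    (auto simp: std_simplex_def sum.distrib sum_distrib_left[symmetric] intro!: add_nonneg_nonneg)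

lemma compact_std_simplex: "compact (std_simplex :: (real^'m::finite) set)"
proof -
  have "closed (std_simplex :: (real^'m) set)"
    unfolding std_simplex_def
    by (intro closed_Collect_conj closed_Collect_all closed_Collect_le closed_Collect_eq
        continuous_intros)
  moreover have "norm v \<le> 1" if "v \<in> std_simplex" for v :: "real^'m"
    using norm_le_l1_cart[of v] that by (simp add: std_simplex_def)
  ultimately show ?thesis by (auto simp: compact_eq_bounded_closed bounded_iff)
qed

lemma std_simplex_nonempty: "(std_simplex :: (real^'m::finite) set) \<noteq> {}"
proof -
  have "axis undefined 1 \<in> (std_simplex :: (real^'m) set)"
    by (auto simp: std_simplex_def axis_def)
  then show ?thesis by blast
qed

lemma compact_profiles: "compact (profiles :: (real^'m::finite^'n::finite) set)"
proof -
  have "(profiles :: (real^'m^'n) set) = (\<Inter>i. (\<lambda>S. S $ i) -` std_simplex)"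
    by (auto simp: profiles_def)
  moreover have "closed (\<Inter>i. (\<lambda>S. (S :: real^'m^'n) $ i) -` std_simplex)"
    by (intro closed_INT ballI closed_vimage compact_imp_closed compact_std_simplex continuous_intros)
  moreover obtain r where r: "\<And>v :: real^'m. v \<in> std_simplex \<Longrightarrow> norm v \<le> r"
    using compact_imp_bounded[OF compact_std_simplex] unfolding bounded_iff by blast
  have "norm S \<le> (\<Sum>i\<in>(UNIV :: 'n set). r)" if "S \<in> profiles" for S :: "real^'m^'n"
  proof -
    have "norm S \<le> (\<Sum>i\<in>UNIV. norm (S $ i))"
      unfolding norm_vec_def by (rule L2_set_le_sum) simp
    also have "\<dots> \<le> (\<Sum>i\<in>(UNIV :: 'n set). r)"
      using that r by (intro sum_mono) (auto simp: profiles_def)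
    finally show ?thesis .
  qed
  then have "bounded (profiles :: (real^'m^'n) set)" unfolding bounded_iff by blast
  ultimately show ?thesis by (simp add: compact_eq_bounded_closed)
qed

lemma others_component: "others S i $ x = (\<Sum>j\<in>UNIV. S $ j $ x) - S $ i $ x"
  by (simp add: others_def sum_component sum.remove[of UNIV i])

section \<open>The oligopoly game\<close>

locale oligopoly =
  fixes u u' :: "'m::finite \<Rightarrow> real \<Rightarrow> real"
    and c :: "real^'m \<Rightarrow> real" and Q :: "real^'m^'m" and b :: "real^'m" and d :: real
  assumes markets: "\<And>x. market (u x) (u' x)"
    and cost: "\<And>v. c v = v \<bullet> (Q *v v) + b \<bullet> v + d"
    and cost_convex: "convex_on std_simplex c"
    and strict: "card {x. \<not> strictly_concave_on {0..} (u x)} \<le> 1 \<or> strictly_convex_on std_simplex c"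
begin

sublocale M: market "u x" "u' x" for x
  by (rule markets)

section \<open>The quadratic cost\<close>

definition gc :: "real^'m \<Rightarrow> real^'m"
  where "gc v = Q *v v + transpose Q *v v + b"

definition q :: "real^'m \<Rightarrow> real"
  where "q h = h \<bullet> (Q *v h)"

text \<open>\<open>Q\<close> is not assumed symmetric, so the gradient of the quadratic form
  involves both \<open>Q\<close> and its transpose.\<close>

lemma gc_inner: "gc v \<bullet> h = h \<bullet> (Q *v v) + v \<bullet> (Q *v h) + b \<bullet> h"
proof -
  have "(transpose Q *v v) \<bullet> h = v \<bullet> (Q *v h)"
    by (simp add: transpose_matrix_vector dot_lmul_matrix)
  then show ?thesis by (simp add: gc_def inner_add_left inner_commute[of h])
qed

lemma cost_expansion: "c (v + h) = c v + gc v \<bullet> h + q h"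
  by (simp add: cost gc_inner q_def matrix_vector_right_distrib inner_add_left inner_add_right)

lemma gc_diff_inner: "(gc w - gc v) \<bullet> (w - v) = 2 * q (w - v)"
  by (simp add: inner_diff_left gc_inner q_def matrix_vector_mult_diff_distrib
      inner_diff_right)

lemma cost_has_derivative: "(c has_derivative (\<lambda>h. gc v \<bullet> h)) (at v within A)"
proof -
  have "((*v) Q has_derivative (*v) Q) (at v within A)"
    by (intro bounded_linear_imp_has_derivative) simp
  then have "((\<lambda>v. v \<bullet> (Q *v v) + b \<bullet> v + d) has_derivative (\<lambda>h. gc v \<bullet> h)) (at v within A)"
    by (auto intro!: derivative_eq_intros simp: gc_inner)
  then show ?thesis by (simp add: cost[abs_def])
qed

text \<open>The midpoint convexity gap of a quadratic function is a quarter of its quadratic form.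
  Convexity of the cost on the simplex thus becomes a sign of \<open>q\<close> on differences of
  strategies.\<close>

lemma q_midpoint: "c ((1/2) *\<^sub>R w + (1 - 1/2) *\<^sub>R v) = (1/2) * c w + (1 - 1/2) * c v - q (w - v) / 4"
proof -
  have m: "(1/2) *\<^sub>R w + (1 - 1/2) *\<^sub>R v = v + (1/2) *\<^sub>R (w - v)"
    by (simp add: vec_eq_iff field_simps)
  have "q ((1/2) *\<^sub>R (w - v)) = q (w - v) / 4"
    by (simp add: q_def matrix_vector_mult_scaleR)
  moreover have "c w = c v + gc v \<bullet> (w - v) + q (w - v)"
    using cost_expansion[of v "w - v"] by simp
  ultimately show ?thesis unfolding m cost_expansion by (simp add: algebra_simps)
qed

lemma q_nonneg:
  assumes "v \<in> std_simplex" "w \<in> std_simplex" shows "0 \<le> q (w - v)"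
proof -
  have "c ((1/2) *\<^sub>R w + (1 - 1/2) *\<^sub>R v) \<le> (1/2) * c w + (1 - 1/2) * c v"
    using cost_convex[unfolded convex_on_def, THEN conjunct2, rule_format, of w v "1/2" "1 - 1/2"] assms
    by simp
  then show ?thesis unfolding q_midpoint by simp
qed

lemma q_pos:
  assumes "strictly_convex_on std_simplex c" "v \<in> std_simplex" "w \<in> std_simplex" "v \<noteq> w"
  shows "0 < q (w - v)"
proof -
  have "c ((1/2) *\<^sub>R w + (1 - 1/2) *\<^sub>R v) < (1/2) * c w + (1 - 1/2) * c v"
    using assms(1)[unfolded strictly_convex_on_def, THEN conjunct2, rule_format, of w v "1/2"] assms
    by auto
  then show ?thesis unfolding q_midpoint by simp
qed

section \<open>The field of payoff gradients\<close>

definition F :: "real^'m^'n::finite \<Rightarrow> real^'m^'n"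
  where "F S = (\<chi> i. (\<chi> x. M.marg x (S $ i $ x) (\<Sum>j\<in>UNIV. S $ j $ x)) - gc (S $ i))"

text \<open>The common value of \<open>F\<close> when each of \<open>n\<close> firms plays \<open>y\<close>.\<close>
definition H :: "real \<Rightarrow> real^'m \<Rightarrow> real^'m"
  where "H n y = (\<chi> x. M.marg x (y $ x) (n * y $ x)) - gc y"

lemma profiles_component:
  fixes S :: "real^'m^'n::finite"
  assumes "S \<in> profiles"
  shows "0 \<le> S $ i $ x" "S $ i $ x \<le> (\<Sum>j\<in>UNIV. S $ j $ x)"
proof -
  have *: "0 \<le> S $ j $ x" for j using assms by (auto simp: profiles_def std_simplex_def)
  show "0 \<le> S $ i $ x" by (rule *)
  show "S $ i $ x \<le> (\<Sum>j\<in>UNIV. S $ j $ x)" using * by (intro member_le_sum) auto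
qed

lemma continuous_on_gc: "continuous_on A (\<lambda>z. gc (f z))" if "continuous_on A f"
  unfolding gc_def
  by (intro continuous_intros that bounded_linear.continuous_on[OF matrix_vector_mul_bounded_linear])

lemma continuous_on_F: "continuous_on profiles (F :: real^'m^'n::finite \<Rightarrow> _)"
  unfolding F_def
  by (intro continuous_intros continuous_on_gc M.continuous_on_marg conjI profiles_component)

text \<open>A Brouwer fixed point of the projected step from \<open>y\<close> to
  \<open>y + H n y\<close> is a solution: the projection's obtuse-angle property at \<open>y\<close>
  is the variational inequality.\<close>

lemma exists_symmetric_solution:
  assumes n: "1 \<le> n"
  obtains y where "y \<in> std_simplex" "\<And>v. v \<in> std_simplex \<Longrightarrow> H n y \<bullet> (v - y) \<le> 0"
proof -
  let ?K = "std_simplex :: (real^'m) set"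
  have K: "closed ?K" by (rule compact_imp_closed[OF compact_std_simplex])
  have "continuous_on ?K (H n)"
    unfolding H_def using mult_right_mono[OF n]
    by (intro continuous_intros continuous_on_gc M.continuous_on_marg) (auto simp: std_simplex_def)
  then have "continuous_on ?K (\<lambda>y. closest_point ?K (y + H n y))"
    by (intro continuous_on_compose2[OF continuous_on_closest_point[of ?K UNIV]] continuous_intros
        convex_std_simplex K std_simplex_nonempty) auto
  moreover have "(\<lambda>y. closest_point ?K (y + H n y)) \<in> ?K \<rightarrow> ?K"
    using closest_point_in_set[OF K std_simplex_nonempty] by blast
  ultimately obtain y where y: "y \<in> ?K" "closest_point ?K (y + H n y) = y"
    by (rule brouwer[OF compact_std_simplex convex_std_simplex std_simplex_nonempty])
  have "H n y \<bullet> (v - y) \<le> 0" if "v \<in> ?K" for v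
    using closest_point_dot[OF convex_std_simplex K that, of "y + H n y"] y by simp
  with y that show thesis by blast
qed

text \<open>Supplies are nonnegative, so a zero total forces a zero own supply; the value of
  \<open>pbar\<close> at 0 is then multiplied by 0.\<close>

lemma payoff_eq:
  assumes "S \<in> profiles" "v \<in> orthant"
  shows "payoff u c i v S = (\<Sum>x\<in>UNIV. v $ x * M.pbar x (v $ x + others S i $ x)) - c v"
proof -
  have o: "0 \<le> others S i $ x" for x
    using profiles_component(2)[OF assms(1)] by (simp add: others_component)
  have v: "0 \<le> v $ x" for x using assms by (simp add: orthant_def)
  have "(let sx = v $ x + others S i $ x in if sx = 0 then 0 else price u x sx * v $ x)
      = v $ x * M.pbar x (v $ x + others S i $ x)" for x
    using o[of x] v[of x] by (auto simp: Let_def price_def M.pbar_def add_nonneg_eq_0_iff)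
  then show ?thesis by (simp add: payoff_def)
qed

lemma payoff_has_derivative:
  fixes S :: "real^'m^'n::finite"
  assumes S: "S \<in> profiles"
  shows "((\<lambda>v. payoff u c i v S) has_derivative (\<lambda>h. F S $ i \<bullet> h)) (at (S $ i) within orthant)"
proof -
  have Si: "S $ i \<in> orthant" using profiles_component(1)[OF S] by (simp add: orthant_def)
  have "((\<lambda>v. v $ x * M.pbar x (v $ x + others S i $ x)) has_derivative
      (\<lambda>h. M.marg x (S $ i $ x) (\<Sum>j\<in>UNIV. S $ j $ x) * h $ x)) (at (S $ i) within orthant)" for x
  proof -
    let ?r = "others S i $ x"
    have "((\<lambda>t. t * M.pbar x (t + ?r)) has_derivative
        (*) (M.marg x (S $ i $ x) (S $ i $ x + ?r))) (at (S $ i $ x) within {0..})"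
      using M.revenue_has_derivative[of "S $ i $ x" ?r x] profiles_component[OF S]
      by (simp add: has_field_derivative_def others_component)
    then have "((\<lambda>t. t * M.pbar x (t + ?r)) has_derivative
        (*) (M.marg x (S $ i $ x) (S $ i $ x + ?r))) (at (S $ i $ x) within (\<lambda>v. v $ x) ` orthant)"
      by (rule has_derivative_subset) (auto simp: orthant_def)
    moreover have "((\<lambda>v. v $ x) has_derivative (\<lambda>h. h $ x)) (at (S $ i) within orthant)"
      by (intro bounded_linear_imp_has_derivative bounded_linear_vec_nth)
    ultimately show ?thesis
      using diff_chain_within[of "\<lambda>v. v $ x" "\<lambda>h. h $ x" "S $ i" orthant]
      by (simp add: o_def others_component)
  qed
  then have "((\<lambda>v. (\<Sum>x\<in>UNIV. v $ x * M.pbar x (v $ x + others S i $ x)) - c v) has_derivative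
      (\<lambda>h. (\<Sum>x\<in>UNIV. M.marg x (S $ i $ x) (\<Sum>j\<in>UNIV. S $ j $ x) * h $ x) - gc (S $ i) \<bullet> h))
      (at (S $ i) within orthant)"
    by (intro has_derivative_diff has_derivative_sum cost_has_derivative)
  moreover have "(\<Sum>x\<in>UNIV. M.marg x (S $ i $ x) (\<Sum>j\<in>UNIV. S $ j $ x) * h $ x) - gc (S $ i) \<bullet> h
      = F S $ i \<bullet> h" for h
    by (simp add: F_def inner_diff_left) (simp add: inner_vec_def)
  ultimately have "((\<lambda>v. (\<Sum>x\<in>UNIV. v $ x * M.pbar x (v $ x + others S i $ x)) - c v) has_derivative
      (\<lambda>h. F S $ i \<bullet> h)) (at (S $ i) within orthant)" by simp
  from has_derivative_transform[OF Si payoff_eq[OF S] this] show ?thesis .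
qed

text \<open>The derivative within the orthant is unique, because every orthant point can be moved a
  little in each positive coordinate direction without leaving it. The choice in
  \<open>own_grad\<close> is therefore determined.\<close>

lemma own_grad_eq:
  fixes S :: "real^'m^'n::finite"
  assumes S: "S \<in> profiles"
  shows "own_grad u c i S = F S $ i"
  unfolding own_grad_def
proof (rule some_equality)
  show "((\<lambda>v. payoff u c i v S) has_derivative (\<lambda>h. F S $ i \<bullet> h)) (at (S $ i) within orthant)"
    by (rule payoff_has_derivative[OF S])
  fix g assume g: "((\<lambda>v. payoff u c i v S) has_derivative (\<lambda>h. g \<bullet> h)) (at (S $ i) within orthant)"
  have "(\<lambda>h. g \<bullet> h) = (\<lambda>h. F S $ i \<bullet> h)"
  proof (rule frechet_derivative_unique_within[OF g payoff_has_derivative[OF S]])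
    fix k :: "real^'m" and e :: real assume k: "k \<in> Basis" and e: "e > 0"
    obtain x where "k = axis x 1" using k by (auto simp: Basis_vec_def)
    then have "S $ i + (e / 2) *\<^sub>R k \<in> orthant"
      using e profiles_component(1)[OF S] by (auto simp: orthant_def axis_def)
    then show "\<exists>d. 0 < \<bar>d\<bar> \<and> \<bar>d\<bar> < e \<and> S $ i + d *\<^sub>R k \<in> orthant"
      using e by (intro exI[of _ "e / 2"]) auto
  qed
  then show "g = F S $ i" by (metis vector_eq_rdot)
qed

section \<open>Equilibria and the variational inequality\<close>

lemma std_simplex_subset_orthant: "std_simplex \<subseteq> orthant"
  by (auto simp: std_simplex_def orthant_def)

lemma nash_imp_variational_inequality:
  fixes S :: "real^'m^'n::finite"
  assumes N: "nash_equilibrium u c S" and v: "v \<in> std_simplex"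
  shows "F S $ i \<bullet> (v - S $ i) \<le> 0"
proof -
  have S: "S \<in> profiles" using N by (simp add: nash_equilibrium_def)
  then have Si: "S $ i \<in> std_simplex" by (simp add: profiles_def)
  show ?thesis
    using has_derivative_nonpos_at_max[OF has_derivative_subset[OF payoff_has_derivative[OF S]
          std_simplex_subset_orthant] convex_std_simplex Si v] N
    by (simp add: nash_equilibrium_def)
qed

text \<open>Revenue lies below, and cost above, its tangent in the own strategy, so the first-order
  condition bounds every deviation globally.\<close>

lemma symmetric_nash:
  assumes y: "y \<in> std_simplex"
    and vi: "\<And>v. v \<in> std_simplex \<Longrightarrow> H (real CARD('n)) y \<bullet> (v - y) \<le> 0"
  shows "nash_equilibrium u c (\<chi> i::'n::finite. y)"
  unfolding nash_equilibrium_def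
proof (intro conjI allI ballI)
  let ?S = "\<chi> i::'n. y" and ?n = "real CARD('n)"
  show S: "?S \<in> profiles" using y by (simp add: profiles_def)
  fix i :: 'n and v :: "real^'m" assume v: "v \<in> std_simplex"
  have o: "others ?S i $ x = ?n * y $ x - y $ x" for x
    by (simp add: others_component)
  have n: "?n \<ge> 1" by (simp add: Suc_le_eq)
  have nn: "0 \<le> v $ x" "0 \<le> y $ x" for x using v y by (auto simp: std_simplex_def)
  have "v $ x * M.pbar x (v $ x + others ?S i $ x) \<le> y $ x * M.pbar x (y $ x + others ?S i $ x)
      + M.marg x (y $ x) (?n * y $ x) * (v $ x - y $ x)" for x
    using M.revenue_below_tangent[of "v $ x" "y $ x" "others ?S i $ x" x] nn[of x]
      mult_right_mono[OF n nn(2)[of x]] by (simp add: o)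
  then have "(\<Sum>x\<in>UNIV. v $ x * M.pbar x (v $ x + others ?S i $ x))
      \<le> (\<Sum>x\<in>UNIV. y $ x * M.pbar x (y $ x + others ?S i $ x)
        + M.marg x (y $ x) (?n * y $ x) * (v $ x - y $ x))"
    by (rule sum_mono)
  also have "\<dots> = (\<Sum>x\<in>UNIV. y $ x * M.pbar x (y $ x + others ?S i $ x))
      + (H ?n y + gc y) \<bullet> (v - y)"
    by (simp add: sum.distrib H_def) (simp add: inner_vec_def)
  finally have "payoff u c i v ?S \<le> payoff u c i y ?S + c y + gc y \<bullet> (v - y) - c v + H ?n y \<bullet> (v - y)"
    using payoff_eq[OF S subsetD[OF std_simplex_subset_orthant v], of i]
      payoff_eq[OF S subsetD[OF std_simplex_subset_orthant y], of i]
    by (simp add: inner_add_left)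
  moreover have "c y + gc y \<bullet> (v - y) \<le> c v"
    using cost_expansion[of y "v - y"] q_nonneg[OF y v] by simp
  ultimately show "payoff u c i v ?S \<le> payoff u c i (?S $ i) ?S"
    using vi[OF v] by simp
qed

section \<open>Strict inequality towards the symmetric profile\<close>

text \<open>Monotonicity of the game holds only relative to symmetric profiles: the heterogeneity
  of the firms then enters each market through \<open>p' (s) * \<Sum> (a i - z)\<^sup>2 \<le> 0\<close>
  (see \<open>marg_monotone_identity\<close>).\<close>
lemma variational_stability:
  fixes S :: "real^'m^'n::finite"
  assumes S: "S \<in> profiles" and y: "y \<in> std_simplex"
    and vi: "\<And>v. v \<in> std_simplex \<Longrightarrow> H (real CARD('n)) y \<bullet> (v - y) \<le> 0"
    and ne: "S \<noteq> (\<chi> i. y)"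
  shows "F S \<bullet> (S - (\<chi> i. y)) < 0"
proof -
  let ?n = "real CARD('n)"
  have Si: "S $ i \<in> std_simplex" for i using S by (simp add: profiles_def)
  define A where "A = (\<lambda>x. \<Sum>i\<in>UNIV. (S $ i $ x - y $ x) *
    (M.marg x (S $ i $ x) (\<Sum>j\<in>UNIV. S $ j $ x) - M.marg x (y $ x) (?n * y $ x)))"
  define B where "B = (\<Sum>i\<in>UNIV. 2 * q (S $ i - y))"
  have y0: "0 \<le> y $ x" for x using y by (simp add: std_simplex_def)
  have A: "A x \<le> 0" for x
    unfolding A_def using M.marg_monotone(1)[of "\<lambda>i. S $ i $ x"] profiles_component(1)[OF S] y0
    by blast
  have A': "A x < 0" if "strictly_concave_on {0..} (u x)" "S $ i $ x \<noteq> y $ x" for x i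
    unfolding A_def
    using M.marg_monotone(2)[of "\<lambda>i. S $ i $ x"] profiles_component(1)[OF S] y0 that by blast
  have q: "0 \<le> q (S $ i - y)" for i using q_nonneg[OF y Si] .
  then have B: "B \<ge> 0" unfolding B_def by (intro sum_nonneg) simp
  obtain i where i: "S $ i \<noteq> y" using ne by (auto simp: vec_eq_iff)
  have sA: "sum A UNIV \<le> 0" using A by (intro sum_nonpos)
  have "sum A UNIV - B < 0"
    using strict
  proof
    assume "strictly_convex_on std_simplex c"
    then have "0 < 2 * q (S $ i - y)" using q_pos[OF _ y Si] i by auto
    then have "B > 0" unfolding B_def using q by (intro sum_pos2[of UNIV i]) auto
    with sA show ?thesis by simp
  next
    assume card: "card {x. \<not> strictly_concave_on {0..} (u x)} \<le> 1"
    have "\<exists>x. strictly_concave_on {0..} (u x) \<and> S $ i $ x \<noteq> y $ x"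
    proof (rule ccontr)
      assume "\<not> ?thesis"
      then have *: "{x. S $ i $ x \<noteq> y $ x} \<subseteq> {x. \<not> strictly_concave_on {0..} (u x)}" by blast
      obtain x where x: "S $ i $ x \<noteq> y $ x" using i by (auto simp: vec_eq_iff)
      \<comment> \<open>Two strategies of equal total capacity cannot differ in exactly one market,
        and at most one market is not strictly concave.\<close>
      have eq: "S $ i $ x' = y $ x'" if "x' \<noteq> x" for x'
      proof (rule ccontr)
        assume "S $ i $ x' \<noteq> y $ x'"
        with x * have "{x, x'} \<subseteq> {x. \<not> strictly_concave_on {0..} (u x)}" by blast
        from card_mono[OF _ this] show False using that card by simp
      qed
      have "(\<Sum>k\<in>UNIV. S $ i $ k) = (\<Sum>k\<in>UNIV. y $ k)"
        using Si[of i] y by (simp add: std_simplex_def)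
      moreover have "(\<Sum>k\<in>UNIV - {x}. S $ i $ k) = (\<Sum>k\<in>UNIV - {x}. y $ k)"
        using eq by (intro sum.cong) auto
      ultimately show False using x by (simp add: sum.remove[of UNIV x])
    qed
    then obtain x where "A x < 0" using A' by blast
    then have "sum A UNIV < sum (\<lambda>_. 0) UNIV"
      using sum_strict_mono_ex1[of UNIV A "\<lambda>_. 0"] A by auto
    with B show ?thesis by simp
  qed
  \<comment> \<open>Exchanging the sums over firms and markets separates the market terms
    \<open>A\<close> from the cost term \<open>B\<close>.\<close>
  moreover have "(\<Sum>i\<in>UNIV. (F S $ i - H ?n y) \<bullet> (S $ i - y)) = sum A UNIV - B"
  proof -
    have "(F S $ i - H ?n y) \<bullet> (S $ i - y) = (\<Sum>x\<in>UNIV. (S $ i $ x - y $ x) *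
        (M.marg x (S $ i $ x) (\<Sum>j\<in>UNIV. S $ j $ x) - M.marg x (y $ x) (?n * y $ x)))
        - 2 * q (S $ i - y)" for i
    proof -
      have "F S $ i - H ?n y = (\<chi> x. M.marg x (S $ i $ x) (\<Sum>j\<in>UNIV. S $ j $ x)
          - M.marg x (y $ x) (?n * y $ x)) - (gc (S $ i) - gc y)"
        by (simp add: F_def H_def vec_eq_iff)
      then show ?thesis
        by (simp only: inner_diff_left[of _ "gc (S $ i) - gc y"] gc_diff_inner)
          (simp add: inner_vec_def mult.commute)
    qed
    then show ?thesis
      unfolding A_def B_def by (subst sum.swap) (simp add: sum_subtractf)
  qed
  \<comment> \<open>Subtracting \<open>H\<close> for every firm leaves a remainder that the
    variational inequality makes nonpositive.\<close>
  moreover have "F S \<bullet> (S - (\<chi> i. y)) = (\<Sum>i\<in>UNIV. (F S $ i - H ?n y) \<bullet> (S $ i - y))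
      + (\<Sum>i\<in>UNIV. H ?n y \<bullet> (S $ i - y))"
    by (subst sum.distrib[symmetric]) (simp add: inner_vec_def[of "F S"] inner_diff_left)
  moreover have "(\<Sum>i\<in>UNIV. H ?n y \<bullet> (S $ i - y)) \<le> 0"
    using vi[OF Si] by (intro sum_nonpos)
  ultimately show ?thesis by linarith
qed

section \<open>The projected dynamics and stability\<close>

lemma grad_field_component:
  assumes "S \<in> profiles"
  shows "grad_field u c S $ i = closest_point (tangent_cone std_simplex (S $ i)) (F S $ i)"
  using assms by (simp add: grad_field_def own_grad_eq)

lemma grad_field_norm_le:
  assumes "S \<in> profiles" shows "norm (grad_field u c S) \<le> norm (F S)"
  unfolding norm_vec_def[of "grad_field u c S"] norm_vec_def[of "F S"]
  using assms tangent_cone_projection(1)[OF convex_std_simplex]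
  by (intro L2_set_mono) (auto simp: grad_field_component profiles_def)

lemma grad_field_inner_le:
  assumes "S \<in> profiles" "T \<in> profiles"
  shows "grad_field u c S \<bullet> (S - T) \<le> F S \<bullet> (S - T)"
  unfolding inner_vec_def[of "grad_field u c S"] inner_vec_def[of "F S"]
proof (rule sum_mono)
  fix i
  have "S $ i \<in> std_simplex" "T $ i \<in> std_simplex" using assms by (auto simp: profiles_def)
  from tangent_cone_projection(2)[OF convex_std_simplex this]
  show "grad_field u c S $ i \<bullet> (S - T) $ i \<le> F S $ i \<bullet> (S - T) $ i"
    using assms by (simp add: grad_field_component)
qed

text \<open>Solutions are defined by integrals from 0, whereas the decay argument integrates over
  arbitrary subintervals.\<close>

lemma gap_solution_has_integral:
  assumes X: "gap_solution u c X" and st: "0 \<le> s" "s \<le> t"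
  shows "((\<lambda>\<tau>. grad_field u c (X \<tau>)) has_integral (X t - X s)) {s..t}"
proof -
  let ?f = "\<lambda>\<tau>. grad_field u c (X \<tau>)"
  have I: "(?f has_integral (X r - X 0)) {0..r}" if "0 \<le> r" for r
    using X that by (simp add: gap_solution_def)
  have t: "?f integrable_on {0..t}" using I[of t] st by (auto simp: integrable_on_def)
  have "integral {0..s} ?f + integral {s..t} ?f = integral {0..t} ?f"
    using st t by (rule Henstock_Kurzweil_Integration.integral_combine)
  then have "integral {s..t} ?f = X t - X s"
    using integral_unique[OF I[of s]] integral_unique[OF I[of t]] st by (simp add: algebra_simps)
  moreover have "?f integrable_on {s..t}"
    using t by (rule integrable_subinterval_real) (use st in auto)
  ultimately show ?thesis by (metis has_integral_integral)
qed

text \<open>The distance to the profile never increases, so \<open>\<delta> = \<epsilon>\<close>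
  works for stability, and for attraction it suffices to enter every ball once.\<close>

lemma symmetric_stable:
  assumes y: "y \<in> std_simplex"
    and vi: "\<And>v. v \<in> std_simplex \<Longrightarrow> H (real CARD('n)) y \<bullet> (v - y) \<le> 0"
  shows "globally_asymptotically_stable u c (\<chi> i::'n::finite. y)"
proof -
  define e where "e = (\<chi> i::'n. y)"
  have e: "e \<in> profiles" using y by (simp add: e_def profiles_def)
  have neg: "F S \<bullet> (S - e) < 0" if "S \<in> profiles" "S \<noteq> e" for S
    using variational_stability[OF that(1) y vi] that(2) by (simp add: e_def)
  obtain B where B: "\<And>S. S \<in> profiles \<Longrightarrow> norm (F (S :: real^'m^'n)) \<le> B"
    using compact_imp_bounded[OF compact_continuous_image[OF continuous_on_F compact_profiles]]
    unfolding bounded_iff by blast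
  have decay: "(norm (X t - e))\<^sup>2 \<le> (norm (X s - e))\<^sup>2 - 2 * w * (t - s)"
    if X: "gap_solution u c X" and st: "0 \<le> s" "s \<le> t"
      and w: "\<And>r. r \<in> {s..t} \<Longrightarrow> F (X r) \<bullet> (X r - e) \<le> - w" for X s t w
  proof (rule sqdist_decay[OF st(2)])
    have P: "X r \<in> profiles" if "r \<in> {s..t}" for r
      using X st that by (auto simp: gap_solution_def)
    show "norm (grad_field u c (X r)) \<le> B" if "r \<in> {s..t}" for r
      using grad_field_norm_le[OF P[OF that]] B[OF P[OF that]] by simp
    show "grad_field u c (X r) \<bullet> (X r - e) \<le> - w" if "r \<in> {s..t}" for r
      using grad_field_inner_le[OF P[OF that] e] w[OF that] by simp
    show "((\<lambda>\<tau>. grad_field u c (X \<tau>)) has_integral (X r' - X r)) {r..r'}"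
      if "s \<le> r" "r \<le> r'" for r r'
      using gap_solution_has_integral[OF X] that st by auto
  qed
  have mono: "dist (X t) e \<le> dist (X s) e" if X: "gap_solution u c X" and st: "0 \<le> s" "s \<le> t" for X s t
  proof -
    have "F (X r) \<bullet> (X r - e) \<le> - 0" if "r \<in> {s..t}" for r
      using neg[of "X r"] X st that by (cases "X r = e") (auto simp: gap_solution_def)
    from decay[OF X st this] show ?thesis by (simp add: dist_norm)
  qed
  have attract: "(X \<longlongrightarrow> e) at_top" if X: "gap_solution u c X" for X
  proof (rule tendstoI)
    fix r :: real assume r: "r > 0"
    have "\<exists>T\<ge>0. dist (X T) e < r"
    proof (rule ccontr)
      assume far: "\<not> ?thesis"
      \<comment> \<open>On this compact set the negative continuous function
        \<open>F S \<bullet> (S - e)\<close> attains its maximum, which yields a uniform decay rate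
        \<open>w\<close>.\<close>
      let ?K = "profiles - ball e r"
      have XK: "X t \<in> ?K" if "t \<ge> 0" for t
        using far X that by (auto simp: gap_solution_def dist_commute not_less)
      have "compact ?K" by (intro compact_diff compact_profiles open_ball)
      moreover have "continuous_on ?K (\<lambda>S. F S \<bullet> (S - e))"
        by (intro continuous_intros continuous_on_subset[OF continuous_on_F]) auto
      moreover have "?K \<noteq> {}" using XK[of 0] by auto
      ultimately obtain m where m: "m \<in> ?K" "\<And>S. S \<in> ?K \<Longrightarrow> F S \<bullet> (S - e) \<le> F m \<bullet> (m - e)"
        using continuous_attains_sup[of ?K "\<lambda>S. F S \<bullet> (S - e)"] by blast
      define w where "w = - (F m \<bullet> (m - e))"
      have w: "w > 0" using neg[of m] m(1) r by (cases "m = e") (auto simp: w_def)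
      \<comment> \<open>Long enough for decay at rate \<open>2 * w\<close> to exhaust the initial
        squared distance.\<close>
      define T where "T = (norm (X 0 - e))\<^sup>2 / w"
      have T: "T \<ge> 0" using w by (simp add: T_def)
      have "(norm (X T - e))\<^sup>2 \<le> (norm (X 0 - e))\<^sup>2 - 2 * w * (T - 0)"
        using m(2)[OF XK] by (intro decay[OF X order_refl T]) (auto simp: w_def)
      also have "\<dots> = - (norm (X 0 - e))\<^sup>2" using w by (simp add: T_def)
      finally have "(norm (X T - e))\<^sup>2 \<le> 0"
        using zero_le_power2[of "norm (X 0 - e)"] by linarith
      then have "X T = e" by simp
      then show False using far T r by (metis dist_self)
    qed
    then obtain T where T: "T \<ge> 0" "dist (X T) e < r" by blast
    then have "dist (X t) e < r" if "t \<ge> T" for t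
      using mono[OF X T(1) that] by simp
    then show "\<forall>\<^sub>F t in at_top. dist (X t) e < r"
      by (auto simp: eventually_at_top_linorder)
  qed
  show ?thesis
    unfolding globally_asymptotically_stable_def e_def[symmetric]
  proof (intro conjI allI impI)
    fix \<epsilon> :: real assume \<epsilon>: "\<epsilon> > 0"
    have "dist (X t) e < \<epsilon>" if "gap_solution u c X \<and> dist (X 0) e < \<epsilon>" "t \<ge> 0" for X t
      using mono[of X 0 t] that by simp
    with \<epsilon> show "\<exists>\<delta>>0. \<forall>X. gap_solution u c X \<and> dist (X 0) e < \<delta> \<longrightarrow> (\<forall>t\<ge>0. dist (X t) e < \<epsilon>)"
      by (intro exI[of _ \<epsilon>]) simp
  qed (rule attract)
qed

text \<open>Summing each firm's first-order condition against the deviation \<open>y\<close>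
  contradicts the strict inequality of \<open>variational_stability\<close>.\<close>

lemma nash_unique:
  fixes S :: "real^'m^'n::finite"
  assumes y: "y \<in> std_simplex"
    and vi: "\<And>v. v \<in> std_simplex \<Longrightarrow> H (real CARD('n)) y \<bullet> (v - y) \<le> 0"
    and N: "nash_equilibrium u c S"
  shows "S = (\<chi> i. y)"
proof (rule ccontr)
  assume ne: "S \<noteq> (\<chi> i. y)"
  have S: "S \<in> profiles" using N by (simp add: nash_equilibrium_def)
  have "0 \<le> F S $ i \<bullet> (S $ i - y)" for i
    using nash_imp_variational_inequality[OF N y, of i] by (simp add: inner_diff_right)
  then have "0 \<le> F S \<bullet> (S - (\<chi> i. y))"
    unfolding inner_vec_def[of "F S"] by (intro sum_nonneg) simp
  with variational_stability[OF S y vi ne] show False by simp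
qed

end

theorem theorem2:
  fixes u :: "'m::finite \<Rightarrow> real \<Rightarrow> real"
    and c :: "real^'m \<Rightarrow> real"
  assumes u0: "\<And>x. u x 0 = 0"
    and u_nonneg: "\<And>x t. 0 \<le> t \<Longrightarrow> 0 \<le> u x t"
    and u_concave: "\<And>x. concave_on {0..} (u x)"
    and u_C1: "\<And>x. \<exists>u'. (\<forall>t\<ge>0. (u x has_real_derivative u' t) (at t within {0..}))
                         \<and> continuous_on {0..} u'"
    and c_quadratic: "\<exists>(Q::real^'m^'m) b d. \<forall>v. c v = v \<bullet> (Q *v v) + b \<bullet> v + d"
    and c_convex: "convex_on std_simplex c"
    and c_nonneg: "\<And>v. v \<in> std_simplex \<Longrightarrow> 0 \<le> c v"
    and strict: "card {x. \<not> strictly_concave_on {0..} (u x)} \<le> 1 \<or> strictly_convex_on std_simplex c"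
  shows "\<exists>Se::real^'m^'n::finite. nash_equilibrium u c Se
           \<and> (\<forall>S'. nash_equilibrium u c S' \<longrightarrow> S' = Se)
           \<and> globally_asymptotically_stable u c Se"
proof -
  from u_C1 obtain u' where u': "\<And>x t. 0 \<le> t \<Longrightarrow> (u x has_real_derivative u' x t) (at t within {0..})"
    "\<And>x. continuous_on {0..} (u' x)"
    by metis
  from c_quadratic obtain Q :: "real^'m^'m" and b d where c: "\<And>v. c v = v \<bullet> (Q *v v) + b \<bullet> v + d"
    by blast
  interpret oligopoly u u' c Q b d
    using u0 u_concave u' c c_convex strict by unfold_locales auto
  have "1 \<le> real CARD('n)" by (simp add: Suc_le_eq)
  then obtain y where y: "y \<in> std_simplex" "\<And>v. v \<in> std_simplex \<Longrightarrow> H (real CARD('n)) y \<bullet> (v - y) \<le> 0"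
    by (rule exists_symmetric_solution) blast
  show ?thesis
    using symmetric_nash[OF y] nash_unique[OF y] symmetric_stable[OF y] by blast
qed

end
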